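(* Let $L_4$ be the 2-tape language over the alphabet $\Sigma=\{0,1,\nabla\}$ given by $$L_4=\{(x_1\nabla x_2,\;y)\;:\;x_1,x_2,y\in\{0,1\}^*,\ \text{there is exactly one } j\in\{1,2\}\text{ such that } x_j=y\}.$$ For every $\varepsilon>0$ there exists a quantum finite 2-tape automaton which recognizes $L_4$ with probability $\frac23-\varepsilon$.
   Context: A 2-tape language over $\Sigma$ is a set of pairs of words $L\subseteq\Sigma^*\times\Sigma^*$ (first component: content of tape 1; second component: content of tape 2). Quantum finite 2-tape automaton (QFMA with $m=2$ tapes): a tuple $A=(Q,\Sigma,\delta,q_0,Q_{acc},Q_{rej})$ with $Q$ a finite set of states, $\Sigma$ a finite input alphabet, $q_0\in Q$, disjoint sets $Q_{acc},Q_{rej}\subset Q$ of accepting and rejecting (halting) states, $Q_{non}=Q\setminus(Q_{acc}\cup Q_{rej})$, tape alphabet $\Gamma=\Sigma\cup\{\kappa,\$\}$ where $\kappa,\$\notin\Sigma$ are the left and right endmarkers, and transition function $\delta:Q\times\Gamma^2\times Q\times\{\downarrow,\to\}^2\to\{z\in\mathbb C:|z|\le 1\}$ satisfying the well-formedness conditions: (1) for all $q_1\in Q$, $\sigma\in\Gamma^2$: $\sum_{(q,d)\in Q\times\{\downarrow,\to\}^2}|\delta(q_1,\sigma,q,d)|^2=1$; (2) for all $q_1\ne q_2$ in $Q$ and $\sigma\in\Gamma^2$: $\sum_{(q,d)}\overline{\delta(q_1,\sigma,q,d)}\,\delta(q_2,\sigma,q,d)=0$; (3) for every nonempty $I\subseteq\{1,2\}$,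 all $q_1,q_2\in Q$, all $\sigma_1,\sigma_2\in\Gamma^2$ with $\sigma_1^i=\sigma_2^i$ for $i\notin I$, and all $t_1,t_2\in\{\downarrow,\to\}^I$ with $t_1^j\neq t_2^j$ for every $j\in I$: $\sum_{q\in Q,\ r\in\{\downarrow,\to\}^{\{1,2\}\setminus I}}\overline{\delta(q_1,\sigma_1,q,d_I(r,t_1))}\,\delta(q_2,\sigma_2,q,d_I(r,t_2))=0$, where $d_I(r,t)$ has $i$-th component $t^i$ if $i\in I$ and $r^i$ if $i\notin I$. On input $x=(x^1,x^2)\in(\Sigma^* )^2$, tape $i$ contains $\kappa x^i\$$, of length $|x^i|+2$, viewed as circular (cells numbered $0,\dots,|x^i|+1$, the cell after $\$$ being $\kappa$). A configuration is $|q,s\rangle$ with $q\in Q$ and $0\le s^i\le|x^i|+1$ the head positions; configurations form an orthonormal basis of a finite-dimensional Hilbert space. One step applies the linear operator $U_x^\delta|q',s\rangle=\sum_{(q,d)}\delta(q',\sigma(s),q,d)\,|q,\tau(s,d)\rangle$, where $\sigma^i(s)$ is the symbol in cell $s^i$ of tape $i$, and $\tau^i(s,d)=(s^i+1)\bmod(|x^i|+2)$ if $d^i=\,\to$, $\tau^i(s,d)=s^i$ if $d^i=\,\downarrow$. After each step the state is measured with respect to the decomposition into the spans $E_{acc},E_{rej},E_{non}$ of the configurations whose state lies in $Q_{acc},Q_{rej},Q_{non}$: the outcome "acc" means the input is accepted, "rej" means it is rejected, and on "non" the computation continues from the projected vector. With projections $P_{acc},P_{rej},P_{non}$, $\psi_0=|q_0,(0,0)\rangle$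 and $\psi_{t+1}=P_{non}U_x^\delta\psi_t$ (unnormalized), the acceptance (rejection) probability is $\sum_{t\ge0}\|P_{acc}U_x^\delta\psi_t\|^2$ (resp. $\sum_{t\ge 0}\|P_{rej}U_x^\delta\psi_t\|^2$). An automaton recognizes $L$ with probability $p$ if every input in $L$ is accepted with probability at least $p$ and every input not in $L$ is rejected with probability at least $p$. *)

theory Defs
  imports Complex_Main "HOL-Library.FuncSet"
begin

section \<open>Quantum finite 2-tape automata\<close>

datatype tape = Tape1 | Tape2

instance tape :: finite
proof
  have "(UNIV :: tape set) = {Tape1, Tape2}"
    using tape.exhaust by blast
  then show "finite (UNIV :: tape set)"
    by (metis finite.emptyI finite.insertI)
qed

datatype move = Stay | Right

instance move :: finite
proof
  have "(UNIV :: move set) = {Stay, Right}"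
    using move.exhaust by blast
  then show "finite (UNIV :: move set)"
    by (metis finite.emptyI finite.insertI)
qed

text \<open>The tape alphabet: the input alphabet extended by two fresh endmarkers.\<close>

datatype 'a cell = LeftEnd | Letter 'a | RightEnd

text \<open>
  The input alphabet is the whole (finite) type \<open>'a\<close>; the states form a finite subset of the
  type \<open>'q\<close>. Elements of \<open>\<Gamma>\<^sup>2\<close> and of \<open>{\<down>,\<rightarrow>}\<^sup>2\<close> are functions on \<^typ>\<open>tape\<close>. The values of
  \<open>delta\<close> at arguments outside \<open>states\<close> are irrelevant.
\<close>

record ('q, 'a) qfma =
  states :: "'q set"
  delta :: "'q \<Rightarrow> (tape \<Rightarrow> 'a cell) \<Rightarrow> 'q \<Rightarrow> (tape \<Rightarrow> move) \<Rightarrow> complex"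
  init :: 'q
  acc :: "'q set"
  rej :: "'q set"

definition non :: "('q, 'a) qfma \<Rightarrow> 'q set" where
  "non A = states A - (acc A \<union> rej A)"

definition well_formed1 :: "('q, 'a::finite) qfma \<Rightarrow> bool" where
  "well_formed1 A \<longleftrightarrow>
    (\<forall>q1\<in>states A. \<forall>\<sigma>. (\<Sum>(q, d)\<in>states A \<times> UNIV. (cmod (delta A q1 \<sigma> q d))\<^sup>2) = 1)"

definition well_formed2 :: "('q, 'a::finite) qfma \<Rightarrow> bool" where
  "well_formed2 A \<longleftrightarrow>
    (\<forall>q1\<in>states A. \<forall>q2\<in>states A. \<forall>\<sigma>. q1 \<noteq> q2 \<longrightarrow>
      (\<Sum>(q, d)\<in>states A \<times> UNIV. cnj (delta A q1 \<sigma> q d) * delta A q2 \<sigma> q d) = 0)"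

text \<open>The combined move \<open>d\<^sub>I(r,t)\<close> is \<open>override_on r t I\<close>: it is \<open>t\<close> on \<open>I\<close> and \<open>r\<close> off \<open>I\<close>.\<close>

definition well_formed3 :: "('q, 'a::finite) qfma \<Rightarrow> bool" where
  "well_formed3 A \<longleftrightarrow>
    (\<forall>I :: tape set. I \<noteq> {} \<longrightarrow>
      (\<forall>q1\<in>states A. \<forall>q2\<in>states A. \<forall>\<sigma>1 \<sigma>2. (\<forall>i. i \<notin> I \<longrightarrow> \<sigma>1 i = \<sigma>2 i) \<longrightarrow>
        (\<forall>t1\<in>I \<rightarrow>\<^sub>E UNIV. \<forall>t2\<in>I \<rightarrow>\<^sub>E UNIV. (\<forall>j\<in>I. t1 j \<noteq> t2 j) \<longrightarrow>
          (\<Sum>(q, r)\<in>states A \<times> ((- I) \<rightarrow>\<^sub>E UNIV).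
             cnj (delta A q1 \<sigma>1 q (override_on r t1 I)) *
             delta A q2 \<sigma>2 q (override_on r t2 I)) = 0)))"

definition is_qfma :: "('q, 'a::finite) qfma \<Rightarrow> bool" where
  "is_qfma A \<longleftrightarrow>
    finite (states A) \<and> init A \<in> states A \<and>
    acc A \<subseteq> states A \<and> rej A \<subseteq> states A \<and> acc A \<inter> rej A = {} \<and>
    (\<forall>q1\<in>states A. \<forall>\<sigma>. \<forall>q\<in>states A. \<forall>d. cmod (delta A q1 \<sigma> q d) \<le> 1) \<and>
    well_formed1 A \<and> well_formed2 A \<and> well_formed3 A"


section \<open>Computation\<close>

type_synonym 'a input = "'a list \<times> 'a list"

fun word :: "'a input \<Rightarrow> tape \<Rightarrow> 'a list" where
  "word x Tape1 = fst x"
| "word x Tape2 = snd x"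

definition tape_content :: "'a input \<Rightarrow> tape \<Rightarrow> 'a cell list" where
  "tape_content x i = LeftEnd # map Letter (word x i) @ [RightEnd]"

text \<open>A configuration consists of a state and the head positions.\<close>

type_synonym 'q config = "'q \<times> (tape \<Rightarrow> nat)"

definition configs :: "('q, 'a) qfma \<Rightarrow> 'a input \<Rightarrow> 'q config set" where
  "configs A x = states A \<times> {s. \<forall>i. s i \<le> length (word x i) + 1}"

definition scanned :: "'a input \<Rightarrow> (tape \<Rightarrow> nat) \<Rightarrow> tape \<Rightarrow> 'a cell" where
  "scanned x s = (\<lambda>i. tape_content x i ! s i)"

definition move_heads :: "'a input \<Rightarrow> (tape \<Rightarrow> nat) \<Rightarrow> (tape \<Rightarrow> move) \<Rightarrow> tape \<Rightarrow> nat" where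
  "move_heads x s d =
    (\<lambda>i. case d i of Right \<Rightarrow> (s i + 1) mod (length (word x i) + 2) | Stay \<Rightarrow> s i)"

text \<open>
  A vector of the Hilbert space is the function giving its coordinates with respect to the
  orthonormal basis \<open>configs A x\<close>; coordinates outside this finite set play no role.
\<close>

type_synonym 'q vector = "'q config \<Rightarrow> complex"

definition ket :: "'q config \<Rightarrow> 'q vector" where
  "ket c = (\<lambda>c'. if c' = c then 1 else 0)"

text \<open>The linear extension of the action of \<open>U\<^sub>x\<^sup>\<delta>\<close> on the basis vectors.\<close>

definition evolve :: "('q, 'a) qfma \<Rightarrow> 'a input \<Rightarrow> 'q vector \<Rightarrow> 'q vector" where
  "evolve A x \<psi> = (\<lambda>c.
    \<Sum>(q', s)\<in>configs A x. \<psi> (q', s) *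
      (\<Sum>(q, d)\<in>states A \<times> UNIV.
         delta A q' (scanned x s) q d * ket (q, move_heads x s d) c))"

definition proj :: "'q set \<Rightarrow> 'q vector \<Rightarrow> 'q vector" where
  "proj S \<psi> = (\<lambda>(q, s). if q \<in> S then \<psi> (q, s) else 0)"

definition norm_sq :: "('q, 'a) qfma \<Rightarrow> 'a input \<Rightarrow> 'q vector \<Rightarrow> real" where
  "norm_sq A x \<psi> = (\<Sum>c\<in>configs A x. (cmod (\<psi> c))\<^sup>2)"

primrec psi :: "('q, 'a) qfma \<Rightarrow> 'a input \<Rightarrow> nat \<Rightarrow> 'q vector" where
  "psi A x 0 = ket (init A, \<lambda>_. 0)"
| "psi A x (Suc t) = proj (non A) (evolve A x (psi A x t))"

text \<open>
  For a well-formed automaton the evolution is unitary, so both series converge, with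
  total sum at most 1.
\<close>

definition accept_prob :: "('q, 'a) qfma \<Rightarrow> 'a input \<Rightarrow> real" where
  "accept_prob A x = (\<Sum>t. norm_sq A x (proj (acc A) (evolve A x (psi A x t))))"

definition reject_prob :: "('q, 'a) qfma \<Rightarrow> 'a input \<Rightarrow> real" where
  "reject_prob A x = (\<Sum>t. norm_sq A x (proj (rej A) (evolve A x (psi A x t))))"

definition recognizes :: "('q, 'a) qfma \<Rightarrow> 'a input set \<Rightarrow> real \<Rightarrow> bool" where
  "recognizes A L p \<longleftrightarrow>
    (\<forall>x. (x \<in> L \<longrightarrow> accept_prob A x \<ge> p) \<and> (x \<notin> L \<longrightarrow> reject_prob A x \<ge> p))"


section \<open>The language\<close>

datatype letter = Sym0 | Sym1 | Nabla

instance letter :: finite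
proof
  have "(UNIV :: letter set) = {Sym0, Sym1, Nabla}"
    using letter.exhaust by blast
  then show "finite (UNIV :: letter set)"
    by (metis finite.emptyI finite.insertI)
qed

definition L4 :: "letter input set" where
  "L4 = {(w 1 @ [Nabla] @ w 2, y) | w y.
    w (1::nat) \<in> lists {Sym0, Sym1} \<and> w 2 \<in> lists {Sym0, Sym1} \<and> y \<in> lists {Sym0, Sym1} \<and>
    (\<exists>!j. j \<in> {1, 2} \<and> w j = y)}"

end

theory Submission
  imports Defs "HOL-Library.Countable"
begin

text \<open>
  The automaton tosses a fair three-sided quantum coin and then runs, without further
  interference, one of three reversible deterministic procedures. The first accepts at once. The
  second compares \<open>x\<^sub>1\<close> with \<open>y\<close>, rejecting at the first difference, and then compares \<open>x\<^sub>2\<close> with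
  \<open>y\<close>, accepting at the first difference; it accepts iff \<open>x\<^sub>1 = y \<noteq> x\<^sub>2\<close>. The third does
  the same with \<open>x\<^sub>1\<close> and \<open>x\<^sub>2\<close> exchanged. So on inputs in the language exactly two branches
  accept, and on all other inputs exactly two branches reject. Halting at the first difference
  is what makes the procedures reversible: a head never has to be brought back from a position
  inside a word.
\<close>

section \<open>The automaton\<close>

datatype branch = B0 | B1 | B2

text \<open>
  \<open>Before\<close>, \<open>After\<close>: check that tape 1 contains exactly one \<open>\<nabla>\<close>. \<open>Skip\<close>: move head 1 to \<open>\<nabla>\<close>.
  \<open>Fst1\<close>, \<open>Snd1\<close>: compare \<open>x\<^sub>1\<close> with \<open>y\<close> as first or second comparison; similarly \<open>Fst2\<close>, \<open>Snd2\<close>.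
  \<open>Rewind\<close>: move head 2 from \<open>$\<close> to \<open>\<kappa>\<close>.
\<close>

datatype phase = Start branch | Before | After | Fst1 | Rewind | Snd2 | Skip | Fst2 | Snd1

text \<open>Every phase has its own halting states, as distinct states need distinct successors.\<close>

datatype state = Run phase | Accept phase | Reject phase

instance branch :: finite
proof
  have "(UNIV :: branch set) = {B0, B1, B2}"
    using branch.exhaust by blast
  then show "finite (UNIV :: branch set)"
    by (metis finite.emptyI finite.insertI)
qed

instance phase :: finite
proof
  have "(UNIV :: phase set) = range Start \<union> {Before, After, Fst1, Rewind, Snd2, Skip, Fst2, Snd1}"
  proof (intro set_eqI iffI)
    fix p :: phase
    show "p \<in> range Start \<union> {Before, After, Fst1, Rewind, Snd2, Skip, Fst2, Snd1}"
      by (cases p) auto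
  qed simp
  then show "finite (UNIV :: phase set)"
    by (metis finite.emptyI finite.insertI finite_UnI finite_imageI finite_code)
qed

instance state :: finite
proof
  have "(UNIV :: state set) = range Run \<union> range Accept \<union> range Reject"
  proof (intro set_eqI iffI)
    fix q :: state
    show "q \<in> range Run \<union> range Accept \<union> range Reject"
      by (cases q) auto
  qed simp
  then show "finite (UNIV :: state set)"
    by (metis finite_UnI finite_imageI finite_code)
qed

instance branch :: countable by countable_datatype
instance phase :: countable by countable_datatype
instance state :: countable by countable_datatype

section \<open>Reversible transition table and its completion to permutations\<close>

definition digits :: "letter cell set" where
  "digits = {Letter Sym0, Letter Sym1}"

text \<open>The tapes are circular, so a head returns to \<open>LeftEnd\<close> by running over
  \<open>RightEnd\<close>: \<open>After\<close> does this with head 1, \<open>Fst2\<close> with both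
  heads. Only branch 1 has phases that count the nablas beforehand; in branch 2, \<open>Fst2\<close>
  must reach the end of tape 1 before acceptance becomes possible.\<close>

definition successor :: "phase \<Rightarrow> letter cell \<Rightarrow> letter cell \<Rightarrow> state" where
  "successor p a b = (case p of
      Start i \<Rightarrow>
        (if a = LeftEnd \<and> b = LeftEnd
         then (case i of B0 \<Rightarrow> Accept p | B1 \<Rightarrow> Run Before | B2 \<Rightarrow> Run Skip) else Reject p)
    | Before \<Rightarrow>
        (if b = LeftEnd \<and> a \<in> digits then Run Before
         else if b = LeftEnd \<and> a = Letter Nabla then Run After else Reject p)
    | After \<Rightarrow>
        (if b = LeftEnd \<and> (a \<in> digits \<or> a = RightEnd) then Run After
         else if b = LeftEnd \<and> a = LeftEnd then Run Fst1 else Reject p)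
    | Fst1 \<Rightarrow>
        (if a = b \<and> a \<in> digits then Run Fst1
         else if a = Letter Nabla \<and> b = RightEnd then Run Rewind else Reject p)
    | Rewind \<Rightarrow> (if a = Letter Nabla \<and> b = LeftEnd then Run Snd2 else Reject p)
    | Snd2 \<Rightarrow>
        (if a = b \<and> a \<in> digits then Run Snd2
         else if a = RightEnd \<and> b = RightEnd then Reject p else Accept p)
    | Skip \<Rightarrow>
        (if b = LeftEnd \<and> a \<in> digits then Run Skip
         else if b = LeftEnd \<and> a = Letter Nabla then Run Fst2 else Reject p)
    | Fst2 \<Rightarrow>
        (if a = b \<and> (a \<in> digits \<or> a = RightEnd) then Run Fst2
         else if a = LeftEnd \<and> b = LeftEnd then Run Snd1 else Reject p)
    | Snd1 \<Rightarrow>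
        (if a = b \<and> a \<in> digits then Run Snd1
         else if a = Letter Nabla \<and> b = RightEnd then Reject p else Accept p))"

text \<open>The symbols on which a phase is entered are disjoint from those on which it continues,
  each running phase is entered from at most one other phase, and halting states carry the phase
  they come from.\<close>

lemma successor_inject: "successor p a b = successor p' a b \<longleftrightarrow> p = p'"
  by (cases p; cases p'; auto simp: successor_def digits_def split: branch.splits if_splits)

text \<open>By finiteness the complements of domain and image have equal size, so a bijection
  between them completes \<open>f\<close>.\<close>

lemma ex_bij_extension:
  fixes f :: "'a::finite \<Rightarrow> 'a"
  assumes "inj_on f X"
  shows "\<exists>g. bij g \<and> (\<forall>x\<in>X. g x = f x)"
proof -
  have "card (- X) = card (- f ` X)"
    using assms by (simp add: Compl_eq_Diff_UNIV card_Diff_subset card_image)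
  then obtain h where h: "bij_betw h (- X) (- f ` X)"
    by (metis finite_same_card_bij finite_code)
  define g where "g = (\<lambda>x. if x \<in> X then f x else h x)"
  have "bij_betw g X (f ` X)"
    using assms by (auto simp: g_def bij_betw_def inj_on_def)
  moreover have "bij_betw g (- X) (- f ` X)"
    using h by (subst bij_betw_cong[where g = h]) (auto simp: g_def)
  ultimately have "bij g"
    using bij_betw_combine[of g X "f ` X" "- X" "- f ` X"] by simp
  then show ?thesis
    by (auto simp: g_def)
qed

definition perm :: "(tape \<Rightarrow> letter cell) \<Rightarrow> state \<Rightarrow> state" where
  "perm \<sigma> = (SOME g. bij g \<and> (\<forall>p. g (Run p) = successor p (\<sigma> Tape1) (\<sigma> Tape2)))"

lemma perm: "bij (perm \<sigma>)" "perm \<sigma> (Run p) = successor p (\<sigma> Tape1) (\<sigma> Tape2)"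
proof -
  \<comment> \<open>The values on halting states are placeholders; only the restriction to
    \<open>range Run\<close> is extended.\<close>
  let ?f = "\<lambda>q. case q of Run p \<Rightarrow> successor p (\<sigma> Tape1) (\<sigma> Tape2) | _ \<Rightarrow> q"
  have "inj_on ?f (range Run)"
    by (auto simp: inj_on_def successor_inject)
  from ex_bij_extension[OF this]
  have "\<exists>g. bij g \<and> (\<forall>p. g (Run p) = successor p (\<sigma> Tape1) (\<sigma> Tape2))"
    by auto
  then have "bij (perm \<sigma>) \<and> (\<forall>p. perm \<sigma> (Run p) = successor p (\<sigma> Tape1) (\<sigma> Tape2))"
    unfolding perm_def by (rule someI_ex)
  then show "bij (perm \<sigma>)" "perm \<sigma> (Run p) = successor p (\<sigma> Tape1) (\<sigma> Tape2)"
    by auto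
qed

text \<open>The moves of the heads are determined by the state that is entered.\<close>

definition moves :: "state \<Rightarrow> tape \<Rightarrow> move" where
  "moves q i =
    (case i of
       Tape1 \<Rightarrow> if q \<in> Run ` {Before, After, Skip, Fst1, Snd1, Fst2, Snd2} then Right else Stay
     | Tape2 \<Rightarrow> if q \<in> Run ` {Rewind, Fst1, Snd1, Fst2, Snd2} then Right else Stay)"

text \<open>An orthogonal matrix; only its first row matters, the others merely complete it.\<close>

definition coin :: "branch \<Rightarrow> branch \<Rightarrow> complex" where
  "coin i j = complex_of_real (case i of
      B0 \<Rightarrow> 1 / sqrt 3
    | B1 \<Rightarrow> (case j of B0 \<Rightarrow> 1 / sqrt 2 | B1 \<Rightarrow> - 1 / sqrt 2 | B2 \<Rightarrow> 0)
    | B2 \<Rightarrow> (case j of B0 \<Rightarrow> 1 / sqrt 6 | B1 \<Rightarrow> 1 / sqrt 6 | B2 \<Rightarrow> - 2 / sqrt 6))"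

section \<open>Unitarity of the coin toss\<close>

lemma UNIV_branch: "(UNIV :: branch set) = {B0, B1, B2}"
  using branch.exhaust by blast

lemma coin_orthonormal: "(\<Sum>k\<in>UNIV. cnj (coin i k) * coin j k) = (if i = j then 1 else 0)"
proof -
  have "(\<Sum>k\<in>UNIV. cnj (coin i k) * coin j k) =
      complex_of_real (if i = j then 1 else 0)"
    unfolding UNIV_branch coin_def complex_cnj_complex_of_real
    by (cases i; cases j) (simp_all flip: of_real_mult of_real_add add: field_simps)
  then show ?thesis
    by simp
qed

text \<open>A block matrix: the coin on the three start states, the identity elsewhere.\<close>

definition toss :: "state \<Rightarrow> state \<Rightarrow> complex" where
  "toss q q' = (case (q, q') of
      (Run (Start i), Run (Start j)) \<Rightarrow> coin i j
    | _ \<Rightarrow> if q = q' then 1 else 0)"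

lemma toss_simps:
  "toss (Run (Start i)) (Run (Start j)) = coin i j"
  "q \<notin> range (Run \<circ> Start) \<Longrightarrow> toss q q' = (if q = q' then 1 else 0)"
  "q' \<notin> range (Run \<circ> Start) \<Longrightarrow> toss q q' = (if q = q' then 1 else 0)"
  by (auto simp: toss_def split: state.splits phase.splits)

lemma sum_toss_Start:
  fixes f :: "state \<Rightarrow> complex"
  shows "(\<Sum>q\<in>UNIV. toss (Run (Start i)) q * f q) = (\<Sum>j\<in>UNIV. coin i j * f (Run (Start j)))"
proof -
  have "(\<Sum>q\<in>UNIV. toss (Run (Start i)) q * f q) =
      (\<Sum>q\<in>range (Run \<circ> Start). toss (Run (Start i)) q * f q)"
    by (rule sum.mono_neutral_right) (auto simp: toss_simps(3))
  also have "\<dots> = (\<Sum>j\<in>UNIV. coin i j * f (Run (Start j)))"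
    by (subst sum.reindex) (auto simp: inj_on_def toss_simps)
  finally show ?thesis .
qed

lemma sum_toss_other:
  fixes f :: "state \<Rightarrow> complex"
  assumes "q \<notin> range (Run \<circ> Start)"
  shows "(\<Sum>q'\<in>UNIV. toss q q' * f q') = f q"
  using assms by (simp add: toss_simps(2) if_distrib[where f = "\<lambda>x. x * _"] cong: if_cong)

text \<open>Rows in the coin block are orthonormal by \<open>coin_orthonormal\<close>, the others
  are unit vectors, and the two kinds have disjoint supports.\<close>

lemma toss_orthonormal: "(\<Sum>q\<in>UNIV. cnj (toss p q) * toss r q) = (if p = r then 1 else 0)"
proof (cases "r \<in> range (Run \<circ> Start)")
  case True
  then obtain j where r: "r = Run (Start j)" by auto
  have "(\<Sum>q\<in>UNIV. cnj (toss p q) * toss r q) = (\<Sum>k\<in>UNIV. coin j k * cnj (toss p (Run (Start k))))"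
    using sum_toss_Start[of j "\<lambda>q. cnj (toss p q)"] by (simp add: r mult.commute)
  also have "\<dots> = (if p = r then 1 else 0)"
  proof (cases "p \<in> range (Run \<circ> Start)")
    case True
    then obtain i where "p = Run (Start i)" by auto
    with coin_orthonormal[of i j] show ?thesis
      by (simp add: r toss_simps mult.commute)
  next
    case False
    then show ?thesis
      by (auto simp: r toss_simps(2) intro!: sum.neutral)
  qed
  finally show ?thesis .
next
  case False
  then show ?thesis
    using sum_toss_other[OF False, of "\<lambda>q. cnj (toss p q)"] by (simp add: mult.commute toss_simps(3))
qed

text \<open>A transition applies \<open>toss\<close> and then \<open>perm\<close> for the scanned
  symbols, so the amplitude into a state is the \<open>toss\<close> entry at its preimage. States
  are coded as numbers to fit the state type of the theorem.\<close>

definition aut :: "(nat, letter) qfma" where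
  "aut = \<lparr>states = range (to_nat :: state \<Rightarrow> nat),
     delta = (\<lambda>q1 \<sigma> q d. if d = moves (from_nat q)
       then toss (from_nat q1) (inv (perm \<sigma>) (from_nat q)) else 0),
     init = to_nat (Run (Start B0)),
     acc = to_nat ` range Accept, rej = to_nat ` range Reject\<rparr>"

text \<open>Only the move prescribed by the target state survives; reindexing along
  \<open>perm \<sigma>\<close> then cancels the inverse in \<open>delta\<close>.\<close>

lemma sum_states_moves:
  fixes f :: "nat \<Rightarrow> (tape \<Rightarrow> move) \<Rightarrow> 'c::comm_monoid_add"
  assumes "\<And>q d. d \<noteq> moves q \<Longrightarrow> f (to_nat q) d = 0"
  shows "(\<Sum>(q, d)\<in>states aut \<times> UNIV. f q d) =
    (\<Sum>q\<in>UNIV. f (to_nat (perm \<sigma> q)) (moves (perm \<sigma> q)))"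
proof -
  have "(\<Sum>(q, d)\<in>states aut \<times> UNIV. f q d) = (\<Sum>q\<in>states aut. \<Sum>d\<in>UNIV. f q d)"
    by (simp add: sum.cartesian_product)
  also have "\<dots> = (\<Sum>q\<in>UNIV. \<Sum>d\<in>UNIV. f (to_nat (q :: state)) d)"
    by (simp add: aut_def sum.reindex)
  also have "\<dots> = (\<Sum>q\<in>UNIV. f (to_nat q) (moves q))"
  proof (rule sum.cong[OF refl])
    fix q :: state
    have "(\<Sum>d\<in>UNIV. f (to_nat q) d) = (\<Sum>d\<in>{moves q}. f (to_nat q) d)"
      by (rule sum.mono_neutral_right) (auto simp: assms)
    then show "(\<Sum>d\<in>UNIV. f (to_nat q) d) = f (to_nat q) (moves q)"
      by simp
  qed
  also have "\<dots> = (\<Sum>q\<in>UNIV. f (to_nat (perm \<sigma> q)) (moves (perm \<sigma> q)))"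
    by (rule sum.reindex_bij_betw[symmetric]) (rule perm)
  finally show ?thesis .
qed

lemma inv_perm [simp]: "inv (perm \<sigma>) (perm \<sigma> q) = q"
  by (simp add: perm(1) bij_is_inj)

text \<open>This yields the first two well-formedness conditions together; after reindexing it is
  the orthonormality of the rows of \<open>toss\<close>.\<close>

lemma delta_orthonormal:
  assumes "q1 \<in> states aut" "q2 \<in> states aut"
  shows "(\<Sum>(q, d)\<in>states aut \<times> UNIV. cnj (delta aut q1 \<sigma> q d) * delta aut q2 \<sigma> q d) =
    (if q1 = q2 then 1 else 0)"
proof -
  obtain p1 p2 :: state where "q1 = to_nat p1" "q2 = to_nat p2"
    using assms by (auto simp: aut_def)
  then show ?thesis
    by (subst sum_states_moves[where \<sigma> = \<sigma>]) (simp_all add: aut_def toss_orthonormal)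
qed

section \<open>Well-formedness conditions\<close>

lemma well_formed1_aut: "well_formed1 aut"
  unfolding well_formed1_def
proof (intro ballI allI)
  fix q1 \<sigma> assume q1: "q1 \<in> states aut"
  have "complex_of_real (\<Sum>(q, d)\<in>states aut \<times> UNIV. (cmod (delta aut q1 \<sigma> q d))\<^sup>2) =
      (\<Sum>(q, d)\<in>states aut \<times> UNIV. cnj (delta aut q1 \<sigma> q d) * delta aut q1 \<sigma> q d)"
    unfolding of_real_sum
    by (intro sum.cong refl) (clarsimp simp: complex_norm_square[unfolded of_real_power] mult.commute)
  also have "\<dots> = complex_of_real 1"
    using delta_orthonormal[OF q1 q1] by simp
  finally show "(\<Sum>(q, d)\<in>states aut \<times> UNIV. (cmod (delta aut q1 \<sigma> q d))\<^sup>2) = 1"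
    by (simp only: of_real_eq_iff)
qed

text \<open>Each summand vanishes by itself: the two combined moves differ on \<open>I\<close>,
  whereas a nonzero amplitude requires the one move fixed by the entered state.\<close>

lemma well_formed3_aut: "well_formed3 aut"
  unfolding well_formed3_def
proof (intro allI impI ballI sum.neutral)
  fix I :: "tape set" and q1 q2 \<sigma>1 \<sigma>2 qr and t1 t2 :: "tape \<Rightarrow> move"
  assume "I \<noteq> {}" and ne: "\<forall>j\<in>I. t1 j \<noteq> t2 j"
  then obtain j where j: "j \<in> I" by auto
  obtain q :: nat and r :: "tape \<Rightarrow> move" where qr: "qr = (q, r)" by fastforce
  have "\<not> (override_on r t1 I = moves (from_nat q) \<and> override_on r t2 I = moves (from_nat q))"
    using j ne by (metis override_on_apply_in)
  then show "(case qr of (q, r) \<Rightarrow> cnj (delta aut q1 \<sigma>1 q (override_on r t1 I)) *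
      delta aut q2 \<sigma>2 q (override_on r t2 I)) = 0"
    by (auto simp: qr aut_def)
qed

lemma finite_states_aut: "finite (states aut)"
  by (simp add: aut_def)

lemma is_qfma_aut: "is_qfma aut"
proof -
  have "cmod (delta aut q1 \<sigma> q d) \<le> 1" if "q1 \<in> states aut" "q \<in> states aut" for q1 \<sigma> q d
  proof -
    \<comment> \<open>The squared modulus is one term of a sum that equals 1.\<close>
    have "(cmod (delta aut q1 \<sigma> q d))\<^sup>2 \<le>
        (\<Sum>(q, d)\<in>states aut \<times> UNIV. (cmod (delta aut q1 \<sigma> q d))\<^sup>2)"
      using member_le_sum[of "(q, d)" "states aut \<times> UNIV" "\<lambda>(q, d). (cmod (delta aut q1 \<sigma> q d))\<^sup>2"]
      using that finite_states_aut by auto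
    also have "\<dots> = 1"
      using well_formed1_aut that by (auto simp: well_formed1_def)
    finally show ?thesis
      by (simp add: power_le_one_iff)
  qed
  moreover have "well_formed2 aut"
    unfolding well_formed2_def using delta_orthonormal by simp
  moreover have "init aut \<in> states aut" "acc aut \<subseteq> states aut" "rej aut \<subseteq> states aut"
      "acc aut \<inter> rej aut = {}"
    by (auto simp: aut_def)
  ultimately show ?thesis
    unfolding is_qfma_def using well_formed1_aut well_formed3_aut finite_states_aut by blast
qed

section \<open>The evolution\<close>

type_synonym cfg = "state \<times> (tape \<Rightarrow> nat)"

text \<open>The deterministic dynamics with the coin left out.\<close>

definition step :: "letter input \<Rightarrow> cfg \<Rightarrow> cfg" where
  "step x c = (let r = perm (scanned x (snd c)) (fst c) in (r, move_heads x (snd c) (moves r)))"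

definition kt :: "cfg \<Rightarrow> nat vector" where
  "kt c = ket (to_nat (fst c), snd c)"

definition valid :: "letter input \<Rightarrow> cfg set" where
  "valid x = UNIV \<times> {s. \<forall>i. s i \<le> length (word x i) + 1}"

lemma configs_aut: "configs aut x = (\<lambda>c. (to_nat (fst c), snd c)) ` valid x"
  by (force simp: configs_def valid_def aut_def image_iff)

lemma finite_valid: "finite (valid x)"
proof -
  have "{s. \<forall>i. s i \<le> length (word x i) + 1} = Pi\<^sub>E UNIV (\<lambda>i. {..length (word x i) + 1})"
    by (auto simp: PiE_def Pi_def)
  then show ?thesis
    unfolding valid_def by (simp add: finite_PiE)
qed

lemma sum_configs: "sum f (configs aut x) = (\<Sum>c\<in>valid x. f (to_nat (fst c), snd c))"
  unfolding configs_aut by (subst sum.reindex) (auto simp: inj_on_def prod_eq_iff)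

lemma step_valid: "c \<in> valid x \<Longrightarrow> step x c \<in> valid x"
  by (auto simp: valid_def step_def Let_def move_heads_def split: move.split
      intro: order.trans[OF less_imp_le_nat[OF mod_less_divisor]])

lemma kt_apply: "kt c (to_nat q, s) = (if c = (q, s) then 1 else 0)"
  by (auto simp: kt_def ket_def prod_eq_iff)

lemma evolve_sum: "evolve aut x (\<lambda>c. \<Sum>i\<in>I. a i * f i c) = (\<lambda>c. \<Sum>i\<in>I. a i * evolve aut x (f i) c)"
proof
  fix c
  \<comment> \<open>\<open>K v\<close> is the matrix entry of the evolution from \<open>v\<close> to
    \<open>c\<close>; linearity is then an exchange of finite sums.\<close>
  define K where "K = (\<lambda>v. \<Sum>(q, d)\<in>states aut \<times> UNIV.
    delta aut (fst v) (scanned x (snd v)) q d * ket (q, move_heads x (snd v) d) c)"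
  have evolve: "evolve aut x \<psi> c = (\<Sum>v\<in>configs aut x. \<psi> v * K v)" for \<psi>
    by (simp add: evolve_def K_def split_def)
  show "evolve aut x (\<lambda>c. \<Sum>i\<in>I. a i * f i c) c = (\<Sum>i\<in>I. a i * evolve aut x (f i) c)"
    unfolding evolve sum_distrib_left sum_distrib_right mult.assoc by (rule sum.swap)
qed

text \<open>A transition factors into the toss and the deterministic \<open>step\<close>; reindexing
  by \<open>perm\<close> makes the sum run over the outcomes of the toss.\<close>

lemma evolve_kt:
  assumes "c \<in> valid x"
  shows "evolve aut x (kt c) = (\<lambda>c'. \<Sum>q\<in>UNIV. toss (fst c) q * kt (step x (q, snd c)) c')"
proof
  fix c'
  let ?\<sigma> = "scanned x (snd c)"
  let ?g = "\<lambda>c. \<Sum>(q, d)\<in>states aut \<times> UNIV. delta aut (fst c) (scanned x (snd c)) q d *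
      ket (q, move_heads x (snd c) d) c'"
  have "evolve aut x (kt c) c' = (\<Sum>v\<in>valid x. kt c (to_nat (fst v), snd v) * ?g (to_nat (fst v), snd v))"
    unfolding evolve_def sum_configs split_def by simp
  also have "\<dots> = (\<Sum>v\<in>valid x. if v = c then ?g (to_nat (fst v), snd v) else 0)"
    by (intro sum.cong refl) (auto simp: kt_apply)
  also have "\<dots> = ?g (to_nat (fst c), snd c)"
    using assms by (simp add: finite_valid)
  also have "\<dots> = (\<Sum>q\<in>UNIV. delta aut (to_nat (fst c)) ?\<sigma> (to_nat (perm ?\<sigma> q)) (moves (perm ?\<sigma> q)) *
      ket (to_nat (perm ?\<sigma> q), move_heads x (snd c) (moves (perm ?\<sigma> q))) c')"
    unfolding fst_conv snd_conv by (rule sum_states_moves) (simp add: aut_def)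
  also have "\<dots> = (\<Sum>q\<in>UNIV. toss (fst c) q * kt (step x (q, snd c)) c')"
    by (simp add: aut_def kt_def step_def Let_def)
  finally show "evolve aut x (kt c) c' = (\<Sum>q\<in>UNIV. toss (fst c) q * kt (step x (q, snd c)) c')" .
qed

lemma evolve_kt_other:
  assumes "c \<in> valid x" "fst c \<notin> range (Run \<circ> Start)"
  shows "evolve aut x (kt c) = kt (step x c)"
  using sum_toss_other[OF assms(2)] by (simp add: evolve_kt[OF assms(1)])

lemma proj_sum:
  "proj S (\<lambda>c. \<Sum>i\<in>I. a i * kt (f i) c) =
    (\<lambda>c. \<Sum>i\<in>I. (if to_nat (fst (f i)) \<in> S then a i else 0) * kt (f i) c)"
  by (auto simp: proj_def kt_def ket_def fun_eq_iff intro!: sum.cong sum.neutral)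

text \<open>Pythagoras over distinct basis vectors. Distinctness is asked where the coefficient is
  nonzero: a branch already removed by the measurement is still iterated formally and might meet
  another configuration.\<close>

lemma norm_sq_sum:
  assumes "finite I" "inj_on f {i\<in>I. a i \<noteq> 0}" "\<And>i. i \<in> I \<Longrightarrow> f i \<in> valid x"
  shows "norm_sq aut x (\<lambda>c. \<Sum>i\<in>I. a i * kt (f i) c) = (\<Sum>i\<in>I. (cmod (a i))\<^sup>2)"
proof -
  let ?J = "{i\<in>I. a i \<noteq> 0}"
  \<comment> \<open>At most one index with nonzero coefficient hits \<open>v\<close>;
    \<open>the_inv_into\<close> names it.\<close>
  have coord: "(\<Sum>i\<in>I. a i * kt (f i) (to_nat (fst v), snd v)) =
      (if v \<in> f ` ?J then a (the_inv_into ?J f v) else 0)" for v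
  proof -
    have "(\<Sum>i\<in>I. a i * kt (f i) (to_nat (fst v), snd v)) = (\<Sum>i\<in>?J. if f i = v then a i else 0)"
      using assms(1) by (intro sum.mono_neutral_cong_right) (auto simp: kt_apply)
    also have "\<dots> = (if v \<in> f ` ?J then a (the_inv_into ?J f v) else 0)"
    proof (cases "v \<in> f ` ?J")
      case True
      then obtain j where j: "j \<in> ?J" "f j = v" by auto
      have "(\<Sum>i\<in>?J. if f i = v then a i else 0) = (\<Sum>i\<in>?J. if i = j then a i else 0)"
        using j assms(2) by (intro sum.cong refl) (auto dest: inj_onD)
      also have "\<dots> = a j"
        using j assms(1) by simp
      finally show ?thesis
        using j True the_inv_into_f_f[OF assms(2) j(1)] by auto
    qed (auto intro!: sum.neutral)
    finally show ?thesis .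
  qed
  have "norm_sq aut x (\<lambda>c. \<Sum>i\<in>I. a i * kt (f i) c) =
      (\<Sum>v\<in>valid x. if v \<in> f ` ?J then (cmod (a (the_inv_into ?J f v)))\<^sup>2 else 0)"
    unfolding norm_sq_def sum_configs coord by (intro sum.cong refl) auto
  also have "\<dots> = (\<Sum>v\<in>f ` ?J. (cmod (a (the_inv_into ?J f v)))\<^sup>2)"
    using assms(1,3) by (intro sum.mono_neutral_cong_right finite_valid) auto
  also have "\<dots> = (\<Sum>i\<in>?J. (cmod (a i))\<^sup>2)"
    using assms(2) by (subst sum.reindex) (auto simp: the_inv_into_f_f)
  also have "\<dots> = (\<Sum>i\<in>I. (cmod (a i))\<^sup>2)"
    using assms(1) by (intro sum.mono_neutral_left) auto
  finally show ?thesis .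
qed

section \<open>Trajectories of the branches and the superposition they form\<close>

definition traj :: "letter input \<Rightarrow> branch \<Rightarrow> nat \<Rightarrow> cfg" where
  "traj x i n = (step x ^^ n) (Run (Start i), \<lambda>_. 0)"

text \<open>\<open>traj\<close> runs on after halting through arbitrary values of
  \<open>perm\<close>; this predicate records that the measurement has not yet ended the
  branch.\<close>

definition alive :: "letter input \<Rightarrow> branch \<Rightarrow> nat \<Rightarrow> bool" where
  "alive x i n \<longleftrightarrow> (\<forall>k\<le>n. fst (traj x i k) \<in> range Run)"

lemma traj_Suc: "traj x i (Suc n) = step x (traj x i n)"
  by (simp add: traj_def)

lemma traj_valid: "traj x i n \<in> valid x"
  by (induction n) (simp_all add: traj_Suc step_valid, simp add: traj_def valid_def)

text \<open>Every phase belongs to one branch, so the branch can be read off the state; this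
  excludes interference.\<close>

fun phase_branch :: "phase \<Rightarrow> branch" where
  "phase_branch (Start i) = i"
| "phase_branch Skip = B2"
| "phase_branch Fst2 = B2"
| "phase_branch Snd1 = B2"
| "phase_branch _ = B1"

fun state_branch :: "state \<Rightarrow> branch" where
  "state_branch (Run p) = phase_branch p"
| "state_branch (Accept p) = phase_branch p"
| "state_branch (Reject p) = phase_branch p"

lemma state_branch_successor: "state_branch (successor p a b) = phase_branch p"
  by (cases p) (auto simp: successor_def split: branch.splits)

lemma successor_not_Start: "successor p a b \<noteq> Run (Start i)"
  by (cases p) (auto simp: successor_def split: branch.splits)

lemma step_Run: "fst (step x (Run p, s)) = successor p (scanned x s Tape1) (scanned x s Tape2)"
  by (simp add: step_def Let_def perm)

text \<open>Both claims include the moment of halting. The first keeps the branches orthogonal, the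
  second ensures that the coin is never tossed again.\<close>

lemma alive_step:
  assumes "alive x i n"
  shows "state_branch (fst (traj x i (Suc n))) = i" "fst (traj x i (Suc n)) \<noteq> Run (Start j)"
proof -
  obtain p s where ps: "traj x i n = (Run p, s)"
    using assms unfolding alive_def by (metis imageE order_refl prod.collapse)
  have "state_branch (fst (traj x i n)) = i"
    using assms
  proof (induction n)
    case 0
    then show ?case by (simp add: traj_def)
  next
    case (Suc n)
    then have "alive x i n" by (simp add: alive_def)
    with Suc have IH: "state_branch (fst (traj x i n)) = i" by simp
    obtain p s where "traj x i n = (Run p, s)"
      using \<open>alive x i n\<close> unfolding alive_def by (metis imageE order_refl prod.collapse)
    with IH show ?case
      by (simp add: traj_Suc step_Run state_branch_successor)
  qed
  with ps show "state_branch (fst (traj x i (Suc n))) = i" "fst (traj x i (Suc n)) \<noteq> Run (Start j)"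
    by (simp_all add: traj_Suc step_Run state_branch_successor successor_not_Start)
qed

lemma non_aut: "non aut = to_nat ` range Run"
proof -
  have "q \<in> range Run" if "q \<notin> range Accept" "q \<notin> range Reject" for q
    using that by (cases q) auto
  then show ?thesis
    by (auto simp: non_def aut_def inj_image_mem_iff)
qed

definition weight :: "letter input \<Rightarrow> nat \<Rightarrow> branch \<Rightarrow> complex" where
  "weight x n i = (if alive x i n then 1 / sqrt 3 else 0)"

text \<open>The first toss spreads \<open>Run (Start B0)\<close> evenly over the start states, so
  each branch formally begins in its own \<open>Run (Start i)\<close>. Afterwards the toss is the
  identity on living branches, and the measurement removes those that have halted.\<close>

lemma evolve_psi:
  "evolve aut x (psi aut x n) = (\<lambda>c. \<Sum>i\<in>UNIV. weight x n i * kt (traj x i (Suc n)) c)"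
proof (induction n)
  case 0
  have 0: "psi aut x 0 = kt (Run (Start B0), \<lambda>_. 0)"
    by (simp add: kt_def aut_def)
  have "(Run (Start B0), \<lambda>_. 0) \<in> valid x"
    by (simp add: valid_def)
  from evolve_kt[OF this] show ?case
    unfolding 0 fst_conv snd_conv sum_toss_Start
    by (simp add: traj_def weight_def alive_def coin_def)
next
  case (Suc n)
  \<comment> \<open>Projecting keeps exactly the branches still running at time
    \<open>Suc n\<close>, which turns \<open>weight x n\<close> into
    \<open>weight x (Suc n)\<close>.\<close>
  have "psi aut x (Suc n) = (\<lambda>c. \<Sum>i\<in>UNIV. weight x (Suc n) i * kt (traj x i (Suc n)) c)"
    unfolding psi.simps Suc proj_sum
    by (intro ext sum.cong refl arg_cong2[where f = "(*)"])
      (auto simp: weight_def non_aut alive_def le_Suc_eq)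
  then have "evolve aut x (psi aut x (Suc n)) =
      (\<lambda>c. \<Sum>i\<in>UNIV. weight x (Suc n) i * evolve aut x (kt (traj x i (Suc n))) c)"
    by (simp only: evolve_sum)
  also have "\<dots> = (\<lambda>c. \<Sum>i\<in>UNIV. weight x (Suc n) i * kt (traj x i (Suc (Suc n))) c)"
  proof (intro ext sum.cong refl)
    fix c i
    show "weight x (Suc n) i * evolve aut x (kt (traj x i (Suc n))) c =
        weight x (Suc n) i * kt (traj x i (Suc (Suc n))) c"
    proof (cases "alive x i (Suc n)")
      case True
      then have "alive x i n" by (simp add: alive_def)
      then have "fst (traj x i (Suc n)) \<notin> range (Run \<circ> Start)"
        using alive_step(2)[of x i n] by auto
      then show ?thesis
        by (simp add: evolve_kt_other[OF traj_valid] traj_Suc[of x i "Suc n"])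
    qed (simp add: weight_def)
  qed
  finally show ?case .
qed

section \<open>Halting probabilities\<close>

definition stops :: "letter input \<Rightarrow> state set \<Rightarrow> branch \<Rightarrow> nat \<Rightarrow> bool" where
  "stops x S i n \<longleftrightarrow> alive x i n \<and> fst (traj x i (Suc n)) \<in> S"

lemma norm_sq_halt:
  "norm_sq aut x (proj (to_nat ` S) (evolve aut x (psi aut x n))) =
    (\<Sum>i\<in>UNIV. if stops x S i n then 1 / 3 else 0)"
proof -
  let ?a = "\<lambda>i. if to_nat (fst (traj x i (Suc n))) \<in> to_nat ` S then weight x n i else 0"
  have "inj_on (\<lambda>i. traj x i (Suc n)) {i \<in> UNIV. ?a i \<noteq> 0}"
  \<comment> \<open>The left inverse is \<open>state_branch\<close> applied to the state.\<close>
  proof (rule inj_on_inverseI)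
    fix i assume "i \<in> {i \<in> UNIV. ?a i \<noteq> 0}"
    then have "alive x i n" by (auto simp: weight_def split: if_splits)
    then show "state_branch (fst (traj x i (Suc n))) = i" by (rule alive_step)
  qed
  then have "norm_sq aut x (proj (to_nat ` S) (evolve aut x (psi aut x n))) =
      (\<Sum>i\<in>UNIV. (cmod (?a i))\<^sup>2)"
    unfolding evolve_psi proj_sum by (intro norm_sq_sum traj_valid) auto
  also have "\<dots> = (\<Sum>i\<in>UNIV. if stops x S i n then 1 / 3 else 0)"
    by (intro sum.cong refl)
      (auto simp: weight_def stops_def norm_divide power_divide inj_image_mem_iff)
  finally show ?thesis .
qed

lemma stops_unique:
  assumes "stops x S i n" "stops x S i m" "S \<inter> range Run = {}"
  shows "n = m"
proof -
  have "\<not> n < m" if "stops x S i n" "stops x S i m" for n m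
  proof
    assume "n < m"
    then have "fst (traj x i (Suc n)) \<in> range Run"
      using that(2) by (simp add: stops_def alive_def)
    with that(1) assms(3) show False by (auto simp: stops_def)
  qed
  from this[of n m] this[of m n] assms(1,2) show ?thesis by simp
qed

text \<open>\<open>S\<close> contains halting states only, so each branch enters it at most once and
  contributes 1/3 to at most one term; the series is summed branch by branch.\<close>

lemma halt_prob:
  assumes "S \<inter> range Run = {}"
  shows "(\<Sum>n. norm_sq aut x (proj (to_nat ` S) (evolve aut x (psi aut x n)))) =
    card {i. \<exists>n. stops x S i n} / 3"
proof -
  let ?f = "\<lambda>i n. if stops x S i n then 1 / 3 else (0 :: real)"
  have f_sums: "?f i sums (if \<exists>n. stops x S i n then 1 / 3 else 0)" for i
  proof (cases "\<exists>n. stops x S i n")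
    case True
    then obtain m where m: "stops x S i m" by blast
    have "?f i = (\<lambda>n. if n = m then 1 / 3 else 0)"
    proof
      show "?f i n = (if n = m then 1 / 3 else 0)" for n
        using m stops_unique[OF m _ assms, of n] by (cases "n = m") auto
    qed
    with sums_single[of m "\<lambda>_. 1 / 3 :: real"] have "?f i sums (1 / 3)"
      by (simp only:)
    with True show ?thesis
      by (simp only: if_True)
  next
    case False
    then have "?f i = (\<lambda>_. 0)"
      by auto
    with False show ?thesis
      by simp
  qed
  have "(\<lambda>n. \<Sum>i\<in>UNIV. ?f i n) sums (\<Sum>i\<in>UNIV. if \<exists>n. stops x S i n then 1 / 3 else 0)"
    by (rule sums_sum) (rule f_sums)
  also have "(\<Sum>i\<in>UNIV. if \<exists>n. stops x S i n then 1 / 3 else 0) =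
      real (card {i. \<exists>n. stops x S i n}) / 3"
    by (simp add: sum.If_cases)
  finally show ?thesis
    unfolding norm_sq_halt by (rule sums_unique[symmetric])
qed

section \<open>The three branches\<close>

definition halts :: "letter input \<Rightarrow> cfg \<Rightarrow> state \<Rightarrow> bool" where
  "halts x c h \<longleftrightarrow> (\<exists>n. (\<forall>k\<le>n. fst ((step x ^^ k) c) \<in> range Run) \<and> fst ((step x ^^ Suc n) c) = h)"

lemma halts_stops: "halts x (Run (Start i), \<lambda>_. 0) h \<Longrightarrow> h \<in> S \<Longrightarrow> \<exists>n. stops x S i n"
  by (auto simp: halts_def stops_def alive_def traj_def)

definition pos :: "nat \<Rightarrow> nat \<Rightarrow> tape \<Rightarrow> nat" where
  "pos a b i = (case i of Tape1 \<Rightarrow> a | Tape2 \<Rightarrow> b)"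

lemma pos_0: "pos 0 0 = (\<lambda>_. 0)"
  by (auto simp: pos_def split: tape.split)

lemma length_tape_content: "length (tape_content x i) = length (word x i) + 2"
  by (simp add: tape_content_def)

lemma move_heads_pos:
  "move_heads x (pos a b) d =
    pos (if d Tape1 = Right then Suc a mod length (tape_content x Tape1) else a)
        (if d Tape2 = Right then Suc b mod length (tape_content x Tape2) else b)"
  by (auto simp: move_heads_def pos_def length_tape_content fun_eq_iff split: tape.split move.split)

lemma halts_now:
  assumes "successor p (tape_content x Tape1 ! a) (tape_content x Tape2 ! b) = h"
  shows "halts x (Run p, pos a b) h"
  unfolding halts_def
  by (rule exI[of _ 0]) (use assms in \<open>simp add: step_Run scanned_def pos_def\<close>)

text \<open>Runs are built backwards from the halting step, each application prepending one move;
  this is why \<open>halts\<close> allows any starting configuration.\<close>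

lemma halts_step:
  assumes "successor p (tape_content x Tape1 ! a) (tape_content x Tape2 ! b) = Run p'"
    and "halts x (Run p', move_heads x (pos a b) (moves (Run p'))) h"
  shows "halts x (Run p, pos a b) h"
proof -
  let ?c = "(Run p, pos a b)"
  have step: "step x ?c = (Run p', move_heads x (pos a b) (moves (Run p')))"
    using assms(1) by (simp add: step_def Let_def perm scanned_def pos_def)
  obtain n where n: "\<forall>k\<le>n. fst ((step x ^^ k) (step x ?c)) \<in> range Run"
      "fst ((step x ^^ Suc n) (step x ?c)) = h"
    using assms(2) unfolding halts_def step by blast
  \<comment> \<open>The iterates are regrouped so that the first step is split off instead of the
    last.\<close>
  have "fst ((step x ^^ k) ?c) \<in> range Run" if "k \<le> Suc n" for k
    using that n(1) by (cases k) (auto simp del: funpow.simps simp: funpow_Suc_right)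
  moreover have "fst ((step x ^^ Suc (Suc n)) ?c) = h"
    using n(2) by (simp only: funpow_Suc_right o_apply)
  ultimately show ?thesis
    unfolding halts_def by blast
qed

section \<open>Traversing and comparing words\<close>

lemma Letter_digits: "Letter d \<in> digits \<longleftrightarrow> d \<noteq> Nabla"
  by (cases d) (auto simp: digits_def)

lemma cell_notin_digits [simp]:
  "LeftEnd \<notin> digits" "RightEnd \<notin> digits" "Letter Nabla \<notin> digits"
  by (auto simp: digits_def)

text \<open>Head 2 rests while head 1 crosses \<open>u\<close>. The cell \<delta> behind
  \<open>u\<close> guarantees that no move wraps around, and crossed letters are absorbed into
  \<alpha> in the induction.\<close>

lemma sweep:
  assumes "tape_content x Tape1 = \<alpha> @ map Letter u @ \<delta> # \<beta>" "Nabla \<notin> set u"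
    and "\<And>c. c \<in> digits \<Longrightarrow> successor p c (tape_content x Tape2 ! b) = Run p"
    and "p \<in> {Before, After, Skip}"
    and "halts x (Run p, pos (length \<alpha> + length u) b) h"
  shows "halts x (Run p, pos (length \<alpha>) b) h"
  using assms
proof (induction u arbitrary: \<alpha>)
  case (Cons d u)
  have "halts x (Run p, pos (length (\<alpha> @ [Letter d])) b) h"
    using Cons.prems by (intro Cons.IH) auto
  moreover have "successor p (tape_content x Tape1 ! length \<alpha>) (tape_content x Tape2 ! b) = Run p"
    using Cons.prems(1) Cons.prems(2) Cons.prems(3)[of "Letter d"] by (simp add: Letter_digits eq_commute[of Nabla])
  moreover have "move_heads x (pos (length \<alpha>) b) (moves (Run p)) = pos (length (\<alpha> @ [Letter d])) b"
    using Cons.prems(1,4) by (auto simp: move_heads_pos moves_def)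
  ultimately show ?case
    using halts_step[of p x "length \<alpha>" b p h] by simp
qed simp

lemma lockstep_eq:
  assumes "tape_content x Tape1 = \<alpha> @ map Letter u @ \<delta> # \<beta>"
    and "tape_content x Tape2 = \<gamma> @ map Letter u @ [RightEnd]"
    and "Nabla \<notin> set u" "p \<in> {Fst1, Snd1, Fst2, Snd2}"
    and "halts x (Run p, pos (length \<alpha> + length u) (length \<gamma> + length u)) h"
  shows "halts x (Run p, pos (length \<alpha>) (length \<gamma>)) h"
  using assms
proof (induction u arbitrary: \<alpha> \<gamma>)
  case (Cons d u)
  have "halts x (Run p, pos (length (\<alpha> @ [Letter d])) (length (\<gamma> @ [Letter d]))) h"
    using Cons.prems by (intro Cons.IH) auto
  moreover have "successor p (tape_content x Tape1 ! length \<alpha>) (tape_content x Tape2 ! length \<gamma>) = Run p"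
    using Cons.prems by (auto simp: successor_def Letter_digits)
  moreover have "move_heads x (pos (length \<alpha>) (length \<gamma>)) (moves (Run p)) =
      pos (length (\<alpha> @ [Letter d])) (length (\<gamma> @ [Letter d]))"
    using Cons.prems(1,2,4) by (auto simp: move_heads_pos moves_def)
  ultimately show ?case
    using halts_step[of p x "length \<alpha>" "length \<gamma>" p h] by simp
qed simp

text \<open>Different words show an unequal pair of cells before both terminators are scanned
  together; a proper prefix shows up as a terminator facing a letter. The last hypothesis sends
  every such pair to \<open>h\<close>.\<close>

lemma lockstep_neq:
  assumes "tape_content x Tape1 = \<alpha> @ map Letter u @ \<delta> # \<beta>"
    and "tape_content x Tape2 = \<gamma> @ map Letter v @ [RightEnd]"
    and "Nabla \<notin> set u" "p \<in> {Fst1, Snd1, Fst2, Snd2}" "u \<noteq> v" "\<delta> \<in> {Letter Nabla, RightEnd}"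
    and "\<And>a b. a \<in> insert \<delta> digits \<Longrightarrow> \<not> (a = b \<and> a \<in> digits) \<Longrightarrow> (a, b) \<noteq> (\<delta>, RightEnd) \<Longrightarrow>
      b \<noteq> LeftEnd \<Longrightarrow> successor p a b = h"
  shows "halts x (Run p, pos (length \<alpha>) (length \<gamma>)) h"
  using assms
proof (induction u arbitrary: v \<alpha> \<gamma>)
  case Nil
  \<comment> \<open>The word on tape 1 ends first: \<delta> faces a letter, and even two nablas do
    not count as equal digits.\<close>
  then obtain e v' where v: "v = e # v'"
    by (cases v) auto
  show ?case
    by (rule halts_now, rule Nil.prems(7))
      (use Nil.prems(1,2,6) in \<open>auto simp: v\<close>)
next
  case (Cons d u)
  note prems = Cons.prems
  show ?case
  proof (cases "\<exists>v'. v = d # v'")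
    case True
    then obtain v' where v: "v = d # v'" by auto
    have "halts x (Run p, pos (length (\<alpha> @ [Letter d])) (length (\<gamma> @ [Letter d]))) h"
    proof (rule Cons.IH[where v = v'])
      show "successor p a b = h"
        if "a \<in> insert \<delta> digits" "\<not> (a = b \<and> a \<in> digits)" "(a, b) \<noteq> (\<delta>, RightEnd)" "b \<noteq> LeftEnd" for a b
        using that by (rule prems(7))
    qed (use prems(1-6) in \<open>simp_all add: v\<close>)
    moreover have "successor p (tape_content x Tape1 ! length \<alpha>) (tape_content x Tape2 ! length \<gamma>) = Run p"
      using prems(1-4) by (auto simp: v successor_def Letter_digits)
    moreover have "move_heads x (pos (length \<alpha>) (length \<gamma>)) (moves (Run p)) =
        pos (length (\<alpha> @ [Letter d])) (length (\<gamma> @ [Letter d]))"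
      using prems(1,2,4) by (auto simp: v move_heads_pos moves_def)
    ultimately show ?thesis
      using halts_step[of p x "length \<alpha>" "length \<gamma>" p h] by simp
  next
    \<comment> \<open>Either the current letters differ or tape 2 ends first.\<close>
    case False
    show ?thesis
    proof (rule halts_now, rule prems(7))
      show "tape_content x Tape1 ! length \<alpha> \<in> insert \<delta> digits"
        using prems(1,3) by (simp add: Letter_digits eq_commute[of Nabla])
      show "tape_content x Tape2 ! length \<gamma> \<noteq> LeftEnd"
        using prems(2) by (cases v) auto
      show "\<not> (tape_content x Tape1 ! length \<alpha> = tape_content x Tape2 ! length \<gamma> \<and>
          tape_content x Tape1 ! length \<alpha> \<in> digits)"
        using prems(1,2) False by (cases v) auto
      show "(tape_content x Tape1 ! length \<alpha>, tape_content x Tape2 ! length \<gamma>) \<noteq> (\<delta>, RightEnd)"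
        using prems(1,3,6) by auto
    qed
  qed
qed

section \<open>Outcomes on inputs with no, one or several nablas\<close>

lemma nabla_cases:
  obtains "Nabla \<notin> set u" | v w where "u = v @ Nabla # w" "Nabla \<notin> set v"
  using split_list_first[of Nabla u] that by blast

lemma tape_simps:
  "tape_content (u, y) Tape1 = LeftEnd # map Letter u @ [RightEnd]"
  "tape_content (u, y) Tape2 = LeftEnd # map Letter y @ [RightEnd]"
  by (simp_all add: tape_content_def)

lemma start_step:
  assumes "halts (u, y) (Run (case i of B1 \<Rightarrow> Before | _ \<Rightarrow> Skip), pos 1 0) h" "i \<noteq> B0"
  shows "halts (u, y) (Run (Start i), \<lambda>_. 0) h"
  unfolding pos_0[symmetric]
  by (rule halts_step[where p' = "case i of B1 \<Rightarrow> Before | _ \<Rightarrow> Skip"])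
    (use assms in \<open>auto simp: tape_simps successor_def move_heads_pos moves_def split: branch.split\<close>)

lemma branch0: "halts (u, y) (Run (Start B0), \<lambda>_. 0) (Accept (Start B0))"
  unfolding pos_0[symmetric] by (rule halts_now) (simp add: tape_simps successor_def)


text \<open>The run is traced from its end: second comparison, rewinding, first comparison, nabla
  count. Positions are written as prefix lengths to match the traversal lemmas.\<close>

lemma branch1:
  assumes "Nabla \<notin> set v" "Nabla \<notin> set w"
  shows "halts (v @ Nabla # w, y) (Run (Start B1), \<lambda>_. 0)
    (if v = y \<and> w \<noteq> y then Accept Snd2 else if v = y then Reject Snd2 else Reject Fst1)"
    (is "halts ?x _ ?h")
proof (rule start_step)
  have "halts ?x (Run Fst1, pos (length [LeftEnd :: letter cell]) (length [LeftEnd :: letter cell])) ?h"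
  proof (cases "v = y")
    case True
    have "halts ?x (Run Snd2, pos (length (LeftEnd # map Letter v @ [Letter Nabla])) (length [LeftEnd :: letter cell])) ?h"
    proof (cases "w = y")
      case True
      show ?thesis
      proof (rule lockstep_eq[where u = w and \<delta> = RightEnd and \<beta> = "[]"])
        show "halts ?x (Run Snd2, pos (length (LeftEnd # map Letter v @ [Letter Nabla]) + length w)
            (length [LeftEnd :: letter cell] + length w)) ?h"
          using \<open>v = y\<close> True
          by (intro halts_now) (simp add: tape_simps nth_append successor_def)
      qed (use assms True in \<open>auto simp: tape_simps\<close>)
    next
      case False
      show ?thesis
        by (rule lockstep_neq[where u = w and v = y and \<delta> = RightEnd and \<beta> = "[]"])
          (use assms False \<open>v = y\<close> in \<open>auto simp: tape_simps successor_def\<close>)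
    qed
    \<comment> \<open>Head 1 waits on the nabla, in cell \<open>Suc (length v)\<close>, while head 2
      has wrapped to \<open>LeftEnd\<close>.\<close>
    then have "halts ?x (Run Rewind, pos (Suc (length v)) 0) ?h"
      by (intro halts_step[where p' = Snd2])
        (simp_all add: tape_simps nth_append successor_def move_heads_pos moves_def)
    then have "halts ?x (Run Fst1, pos (length [LeftEnd :: letter cell] + length v) (length [LeftEnd :: letter cell] + length v)) ?h"
      using True by (intro halts_step[where p' = Rewind])
        (simp_all add: tape_simps nth_append successor_def move_heads_pos moves_def)
    then show ?thesis
      by (rule lockstep_eq[rotated 4]) (use assms True in \<open>auto simp: tape_simps\<close>)
  next
    case False
    show ?thesis
      by (rule lockstep_neq[where u = v and v = y and \<delta> = "Letter Nabla"])
        (use assms False in \<open>auto simp: tape_simps successor_def\<close>)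
  qed
  then have "halts ?x (Run After, pos 0 0) ?h"
    by (intro halts_step[where p' = Fst1])
      (simp_all add: tape_simps successor_def move_heads_pos moves_def)
  \<comment> \<open>This is the last cell of tape 1, so the next move of head 1 wraps to cell
    0.\<close>
  then have "halts ?x (Run After, pos (length (LeftEnd # map Letter v @ [Letter Nabla]) + length w) 0) ?h"
    by (intro halts_step[where p' = After])
      (simp_all add: tape_simps nth_append successor_def move_heads_pos moves_def)
  then have "halts ?x (Run After, pos (length (LeftEnd # map Letter v @ [Letter Nabla])) 0) ?h"
    by (rule sweep[rotated 4]) (use assms in \<open>auto simp: tape_simps successor_def\<close>)
  then have "halts ?x (Run Before, pos (length [LeftEnd :: letter cell] + length v) 0) ?h"
    by (intro halts_step[where p' = After])
      (simp_all add: tape_simps nth_append successor_def move_heads_pos moves_def)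
  then have "halts ?x (Run Before, pos (length [LeftEnd :: letter cell]) 0) ?h"
    by (rule sweep[rotated 4]) (use assms in \<open>auto simp: tape_simps successor_def\<close>)
  then show "halts ?x (Run (case B1 of B1 \<Rightarrow> Before | _ \<Rightarrow> Skip), pos 1 0) ?h"
    by simp
qed simp

lemma branch1_no_nabla:
  assumes "Nabla \<notin> set u"
  shows "halts (u, y) (Run (Start B1), \<lambda>_. 0) (Reject Before)"
proof (rule start_step)
  have "halts (u, y) (Run Before, pos (length [LeftEnd :: letter cell] + length u) 0) (Reject Before)"
    by (rule halts_now) (simp add: tape_simps nth_append successor_def)
  then have "halts (u, y) (Run Before, pos (length [LeftEnd :: letter cell]) 0) (Reject Before)"
    by (rule sweep[rotated 4]) (use assms in \<open>auto simp: tape_simps successor_def\<close>)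
  then show "halts (u, y) (Run (case B1 of B1 \<Rightarrow> Before | _ \<Rightarrow> Skip), pos 1 0) (Reject Before)"
    by simp
qed simp

text \<open>\<open>Snd2\<close> accepts at any difference and would accept at a further nabla;
  therefore the count precedes the comparisons and rejects here.\<close>

lemma branch1_two_nablas:
  assumes "Nabla \<notin> set v" "Nabla \<notin> set w"
  shows "halts (v @ Nabla # w @ Nabla # z, y) (Run (Start B1), \<lambda>_. 0) (Reject After)"
    (is "halts ?x _ ?h")
proof (rule start_step)
  have "halts ?x (Run After, pos (length (LeftEnd # map Letter v @ [Letter Nabla]) + length w) 0) ?h"
    by (rule halts_now) (simp add: tape_simps nth_append successor_def)
  then have "halts ?x (Run After, pos (length (LeftEnd # map Letter v @ [Letter Nabla])) 0) ?h"
    by (rule sweep[rotated 4]) (use assms in \<open>auto simp: tape_simps successor_def\<close>)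
  then have "halts ?x (Run Before, pos (length [LeftEnd :: letter cell] + length v) 0) ?h"
    by (intro halts_step[where p' = After])
      (simp_all add: tape_simps nth_append successor_def move_heads_pos moves_def)
  then have "halts ?x (Run Before, pos (length [LeftEnd :: letter cell]) 0) ?h"
    by (rule sweep[rotated 4]) (use assms in \<open>auto simp: tape_simps successor_def\<close>)
  then show "halts ?x (Run (case B1 of B1 \<Rightarrow> Before | _ \<Rightarrow> Skip), pos 1 0) ?h"
    by simp
qed simp

lemma branch2_no_nabla:
  assumes "Nabla \<notin> set u"
  shows "halts (u, y) (Run (Start B2), \<lambda>_. 0) (Reject Skip)"
proof (rule start_step)
  have "halts (u, y) (Run Skip, pos (length [LeftEnd :: letter cell] + length u) 0) (Reject Skip)"
    by (rule halts_now) (simp add: tape_simps nth_append successor_def)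
  then have "halts (u, y) (Run Skip, pos (length [LeftEnd :: letter cell]) 0) (Reject Skip)"
    by (rule sweep[rotated 4]) (use assms in \<open>auto simp: tape_simps successor_def\<close>)
  then show "halts (u, y) (Run (case B2 of B1 \<Rightarrow> Before | _ \<Rightarrow> Skip), pos 1 0) (Reject Skip)"
    by simp
qed simp

text \<open>The part of the run shared by inputs with one and with several nablas.\<close>

lemma branch2_Fst2:
  assumes "Nabla \<notin> set v"
    and "halts (v @ Nabla # w, y)
      (Run Fst2, pos (length (LeftEnd # map Letter v @ [Letter Nabla])) (length [LeftEnd :: letter cell])) h"
  shows "halts (v @ Nabla # w, y) (Run (Start B2), \<lambda>_. 0) h"
    (is "halts ?x _ _")
proof (rule start_step)
  have "halts ?x (Run Skip, pos (length [LeftEnd :: letter cell] + length v) 0) h"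
    using assms(2) by (intro halts_step[where p' = Fst2])
      (simp_all add: tape_simps nth_append successor_def move_heads_pos moves_def)
  then have "halts ?x (Run Skip, pos (length [LeftEnd :: letter cell]) 0) h"
    by (rule sweep[rotated 4]) (use assms in \<open>auto simp: tape_simps successor_def\<close>)
  then show "halts ?x (Run (case B2 of B1 \<Rightarrow> Before | _ \<Rightarrow> Skip), pos 1 0) h"
    by simp
qed simp

text \<open>\<open>Fst2\<close> moves on to \<open>Snd1\<close> only after passing
  \<open>RightEnd\<close> on both tapes, so the second nabla stops it even if the word before that
  nabla equals \<open>y\<close>.\<close>

lemma branch2_two_nablas:
  assumes "Nabla \<notin> set v" "Nabla \<notin> set w"
  shows "halts (v @ Nabla # w @ Nabla # z, y) (Run (Start B2), \<lambda>_. 0) (Reject Fst2)"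
    (is "halts ?x _ ?h")
proof (rule branch2_Fst2)
  show "halts ?x (Run Fst2, pos (length (LeftEnd # map Letter v @ [Letter Nabla]))
      (length [LeftEnd :: letter cell])) ?h"
  proof (cases "w = y")
    case True
    show ?thesis
      by (rule lockstep_eq[where u = w and \<delta> = "Letter Nabla"], goal_cases)
        (use assms True in \<open>auto intro!: halts_now simp: tape_simps nth_append successor_def\<close>)
  next
    case False
    show ?thesis
      by (rule lockstep_neq[where u = w and v = y and \<delta> = "Letter Nabla"])
        (use assms False in \<open>auto simp: tape_simps successor_def\<close>)
  qed
qed (rule assms)

lemma branch2:
  assumes "Nabla \<notin> set v" "Nabla \<notin> set w"
  shows "halts (v @ Nabla # w, y) (Run (Start B2), \<lambda>_. 0)
    (if w = y \<and> v \<noteq> y then Accept Snd1 else if w = y then Reject Snd1 else Reject Fst2)"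
    (is "halts ?x _ ?h")
proof (rule branch2_Fst2)
  show "halts ?x (Run Fst2, pos (length (LeftEnd # map Letter v @ [Letter Nabla]))
      (length [LeftEnd :: letter cell])) ?h"
  proof (cases "w = y")
    case True
    have "halts ?x (Run Snd1, pos (length [LeftEnd :: letter cell]) (length [LeftEnd :: letter cell])) ?h"
    proof (cases "v = y")
      case True
      show ?thesis
        by (rule lockstep_eq[where u = v and \<delta> = "Letter Nabla"])
          (use assms True \<open>w = y\<close> in \<open>auto intro!: halts_now simp: tape_simps nth_append successor_def\<close>)
    next
      case False
      show ?thesis
        by (rule lockstep_neq[where u = v and v = y and \<delta> = "Letter Nabla"])
          (use assms False \<open>w = y\<close> in \<open>auto simp: tape_simps successor_def\<close>)
    qed
    then have "halts ?x (Run Fst2, pos 0 0) ?h"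
      by (intro halts_step[where p' = Snd1])
        (simp_all add: tape_simps successor_def move_heads_pos moves_def)
    \<comment> \<open>After a successful comparison both heads stand on \<open>RightEnd\<close> and
      wrap together; no separate rewinding arises.\<close>
    then have "halts ?x (Run Fst2, pos (length (LeftEnd # map Letter v @ [Letter Nabla]) + length w)
        (length [LeftEnd :: letter cell] + length w)) ?h"
      using True by (intro halts_step[where p' = Fst2])
        (simp_all add: tape_simps nth_append successor_def move_heads_pos moves_def)
    then show ?thesis
      by (rule lockstep_eq[rotated 4]) (use assms True in \<open>auto simp: tape_simps\<close>)
  next
    case False
    show ?thesis
      by (rule lockstep_neq[where u = w and v = y and \<delta> = RightEnd and \<beta> = "[]"])
        (use assms False in \<open>auto simp: tape_simps successor_def\<close>)
  qed
qed (rule assms)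

section \<open>Membership in the language\<close>

lemma lists_digits: "xs \<in> lists {Sym0, Sym1} \<longleftrightarrow> Nabla \<notin> set xs"
  by (auto simp: lists_eq_set) (metis letter.exhaust)

lemma L4_no_nabla: "Nabla \<notin> set u \<Longrightarrow> (u, y) \<notin> L4"
  by (auto simp: L4_def)

text \<open>Nabla-free factors make the splitting unique, and over two indices unique existence
  becomes exclusive or.\<close>

lemma L4_nabla:
  assumes "Nabla \<notin> set v"
  shows "(v @ Nabla # w, y) \<in> L4 \<longleftrightarrow> Nabla \<notin> set w \<and> ((v = y) \<noteq> (w = y))"
    (is "?L \<longleftrightarrow> ?R")
proof
  assume ?L
  then obtain f :: "nat \<Rightarrow> letter list" where
    eq: "v @ Nabla # w = f 1 @ Nabla # f 2" and f: "Nabla \<notin> set (f 1)" "Nabla \<notin> set (f 2)"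
    and ex1: "\<exists>!j. j \<in> {1, 2} \<and> f j = y"
    unfolding L4_def lists_digits by auto
  have "v = f 1" "w = f 2"
    using append_Cons_eq_iff[OF f, of v w] unfolding eq[symmetric] by auto
  moreover have "(f 1 = y) \<noteq> (f 2 = y)"
  proof -
    have "\<not> (f 1 = y \<and> f 2 = y)"
    proof
      assume "f 1 = y \<and> f 2 = y"
      then have "(1 :: nat) = 2"
        using ex1 by blast
      then show False
        by simp
    qed
    then show ?thesis
      using ex1 by auto
  qed
  ultimately show ?R
    using f by simp
next
  assume R: ?R
  define f :: "nat \<Rightarrow> letter list" where "f j = (if j = 1 then v else w)" for j
  have "\<exists>!j. j \<in> {1, 2} \<and> f j = y"
    using R by (intro ex1I[of _ "if v = y then 1 else 2"]) (auto simp: f_def split: if_splits)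
  then show ?L
    unfolding L4_def lists_digits mem_Collect_eq
    using R assms by (intro exI[of _ f] exI[of _ y]) (auto simp: f_def)
qed

section \<open>Counting accepting and rejecting branches\<close>

lemma branches_in_L4:
  assumes "x \<in> L4"
  shows "\<exists>i p. i \<noteq> B0 \<and> halts x (Run (Start i), \<lambda>_. 0) (Accept p)"
proof -
  obtain u y where x: "x = (u, y)" by fastforce
  consider "Nabla \<notin> set u" | v w where "u = v @ Nabla # w" "Nabla \<notin> set v"
    by (rule nabla_cases)
  then show ?thesis
  proof cases
    case 1
    then show ?thesis using assms L4_no_nabla by (simp add: x)
  next
    case 2
    with assms have w: "Nabla \<notin> set w" "(v = y) \<noteq> (w = y)"
      by (simp_all add: x L4_nabla)
    show ?thesis
    \<comment> \<open>The accepting branch is the one whose first comparison succeeds.\<close>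
    proof (cases "v = y")
      case True
      then show ?thesis
        using branch1[OF 2(2) w(1), of y] w by (intro exI[of _ B1] exI[of _ Snd2]) (simp add: x 2(1))
    next
      case False
      then show ?thesis
        using branch2[OF 2(2) w(1), of y] w by (intro exI[of _ B2] exI[of _ Snd1]) (simp add: x 2(1))
    qed
  qed
qed

lemma branches_notin_L4:
  assumes "x \<notin> L4" "i \<noteq> B0"
  shows "\<exists>p. halts x (Run (Start i), \<lambda>_. 0) (Reject p)"
proof -
  obtain u y where x: "x = (u, y)" by fastforce
  have i: "i = B1 \<or> i = B2"
    using assms(2) by (cases i) auto
  consider "Nabla \<notin> set u" | v w where "u = v @ Nabla # w" "Nabla \<notin> set v"
    by (rule nabla_cases)
  then show ?thesis
  proof cases
    case 1
    then show ?thesis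
      using i branch1_no_nabla branch2_no_nabla x by blast
  next
    case 2
    consider "Nabla \<notin> set w" | w' z where "w = w' @ Nabla # z" "Nabla \<notin> set w'"
      by (rule nabla_cases)
    then show ?thesis
    proof cases
      case w: 1
      \<comment> \<open>Both comparisons have the same result: if they succeed, branches 1 and 2
        reject in the second comparison, otherwise in the first.\<close>
      then have "(v = y) = (w = y)"
        using assms(1) 2 by (simp add: x L4_nabla)
      then show ?thesis
        using branch1[OF 2(2) w, of y] branch2[OF 2(2) w, of y] i
        unfolding x 2(1) by (cases "w = y") auto
    next
      case w: 2
      then show ?thesis
        using i branch1_two_nablas[OF 2(2) w(2)] branch2_two_nablas[OF 2(2) w(2)]
        unfolding x 2(1) w(1) by blast
    qed
  qed
qed

lemma card_stops_ge_2:
  assumes "i \<noteq> j" "\<exists>n. stops x S i n" "\<exists>n. stops x S j n"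
  shows "2 \<le> card {i. \<exists>n. stops x S i n}"
proof -
  have "card {i, j} \<le> card {i. \<exists>n. stops x S i n}"
    using assms by (intro card_mono) auto
  with assms(1) show ?thesis by simp
qed

lemma aut_recognizes: "recognizes aut L4 (2 / 3)"
  unfolding recognizes_def
proof (intro allI conjI impI)
  fix x assume "x \<in> L4"
  then obtain i p where "i \<noteq> B0" "halts x (Run (Start i), \<lambda>_. 0) (Accept p)"
    using branches_in_L4 by blast
  moreover have "halts x (Run (Start B0), \<lambda>_. 0) (Accept (Start B0))"
    using branch0 by (cases x) simp
  ultimately have "2 \<le> card {i. \<exists>n. stops x (range Accept) i n}"
    by (intro card_stops_ge_2[of B0 i] halts_stops) auto
  moreover have "accept_prob aut x = card {i. \<exists>n. stops x (range Accept) i n} / 3"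
    using halt_prob[of "range Accept" x] by (auto simp: accept_prob_def aut_def)
  ultimately show "2 / 3 \<le> accept_prob aut x"
    by simp
next
  fix x assume "x \<notin> L4"
  then obtain p1 p2 where "halts x (Run (Start B1), \<lambda>_. 0) (Reject p1)"
      "halts x (Run (Start B2), \<lambda>_. 0) (Reject p2)"
    using branches_notin_L4 by (metis branch.distinct(1,3))
  then have "2 \<le> card {i. \<exists>n. stops x (range Reject) i n}"
    by (intro card_stops_ge_2[of B1 B2] halts_stops) auto
  moreover have "reject_prob aut x = card {i. \<exists>n. stops x (range Reject) i n} / 3"
    using halt_prob[of "range Reject" x] by (auto simp: reject_prob_def aut_def)
  ultimately show "2 / 3 \<le> reject_prob aut x"
    by simp
qed

lemma recognizes_antimono: "recognizes A L p \<Longrightarrow> q \<le> p \<Longrightarrow> recognizes A L q"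
  unfolding recognizes_def by (meson order.trans)

theorem theorem3p7:
  fixes \<epsilon> :: real
  assumes "\<epsilon> > 0"
  shows "\<exists>A :: (nat, letter) qfma. is_qfma A \<and> recognizes A L4 (2 / 3 - \<epsilon>)"
  \<comment> \<open>The automaton attains 2/3 itself and is the same for every \<epsilon>.\<close>
  using is_qfma_aut recognizes_antimono[OF aut_recognizes, of "2 / 3 - \<epsilon>"] assms by auto

end
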